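(* Let $m,n,r$ be positive integers such that $m\ge n>r\ge 2$. Let $\mathcal{H}=(V,\mathcal{E})$ be an $r$-uniform multi-hypergraph with $|V|=n$ vertices and $|\mathcal{E}|=m$ edges (counted with multiplicity), and let $X_{\mathcal{H}}$ be the number of vertices with non-zero in-degree after a random orientation on the edges of $\mathcal{H}$. Then \[ H(X_{\mathcal{H}}) \le \frac{1}{2}\log(n) + \frac{1}{2}\log(\pi e). \]
   Context: Throughout, $\log$ denotes the logarithm with base $2$. The Shannon entropy of a random variable $X$ taking values in a finite set $S$ is $H(X) = -\sum_{s\in S}\mathbb{P}[X=s]\cdot\log\mathbb{P}[X=s]$, with the convention $0\log 0=0$. An $r$-uniform multi-hypergraph $\mathcal{H}=(V,\mathcal{E})$ consists of a finite vertex set $V$ and a finite multiset $\mathcal{E}$ of subsets of $V$ (edges), each of cardinality exactly $r$; the same edge may appear more than once in $\mathcal{E}$, and isolated vertices are allowed. A random orientation on the edges of $\mathcal{H}$ means that each edge (each copy of a repeated edge separately) is oriented towards one of its $r$ elements, each element being chosen with probability $1/r$, independently of all other edges. The in-degree $\deg^{-}_{\mathcal{H}}(v)$ of a vertex $v\in V$ is the number of edges that are oriented towards $v$. Thus $X_{\mathcal{H}} = |\{v\in V : \deg^{-}_{\mathcal{H}}(v)>0\}|$. *)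

theory Defs
  imports "HOL-Probability.Probability"
begin

definition uniform_multi_hypergraph :: "nat \<Rightarrow> 'v set \<Rightarrow> 'v set multiset \<Rightarrow> bool" where
  "uniform_multi_hypergraph r V E \<longleftrightarrow> finite V \<and> (\<forall>e\<in>#E. e \<subseteq> V \<and> card e = r)"

text \<open>
  The copies of a repeated edge are oriented separately, so they are told apart by an index:
  the pair \<open>(e, i)\<close> with \<open>i < count E e\<close> is the \<open>i\<close>-th copy of the edge \<open>e\<close>.
\<close>

definition edge_copies :: "'v set multiset \<Rightarrow> ('v set \<times> nat) set" where
  "edge_copies E = (SIGMA e:set_mset E. {..<count E e})"

text \<open>
  An orientation maps each edge copy to the vertex it points to. Its value on pairs that are not
  edge copies is a dummy and is never used.
\<close>

definition random_orientation :: "'v set multiset \<Rightarrow> ('v set \<times> nat \<Rightarrow> 'v) pmf" where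
  "random_orientation E = Pi_pmf (edge_copies E) undefined (\<lambda>(e, i). pmf_of_set e)"

definition in_degree :: "'v set multiset \<Rightarrow> ('v set \<times> nat \<Rightarrow> 'v) \<Rightarrow> 'v \<Rightarrow> nat" where
  "in_degree E \<omega> v = card {c \<in> edge_copies E. \<omega> c = v}"

definition num_nonzero_in_degree ::
    "'v set \<Rightarrow> 'v set multiset \<Rightarrow> ('v set \<times> nat \<Rightarrow> 'v) \<Rightarrow> nat" where
  "num_nonzero_in_degree V E \<omega> = card {v \<in> V. in_degree E \<omega> v > 0}"

text \<open>
  The library's entropy in base 2 of a random variable on a discrete probability space. The lemma
  \<open>shannon_entropy_eq_sum\<close> below gives the usual formula when the variable takes finitely many
  values.
\<close>

definition shannon_entropy :: "'a pmf \<Rightarrow> ('a \<Rightarrow> 'b) \<Rightarrow> real" where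
  "shannon_entropy p X = prob_space.entropy (measure_pmf p) 2 (count_space (range X)) X"

lemma shannon_entropy_eq_sum:
  assumes S: "finite S" "range X \<subseteq> S"
  shows "shannon_entropy p X =
    - (\<Sum>s\<in>S. measure_pmf.prob p {\<omega>. X \<omega> = s} * log 2 (measure_pmf.prob p {\<omega>. X \<omega> = s}))"
proof -
  interpret information_space "measure_pmf p" 2
    by unfold_locales auto
  have fin: "finite (range X)"
    using S finite_subset by blast
  have "simple_distributed (measure_pmf p) X (\<lambda>s. measure_pmf.prob p {\<omega>. X \<omega> = s})"
    by (rule measure_pmf.simple_distributedI) (auto simp: simple_function_def fin vimage_def)
  from entropy_simple_distributed[OF this]
  have "shannon_entropy p X = - (\<Sum>s\<in>range X. measure_pmf.prob p {\<omega>. X \<omega> = s} *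
      log 2 (measure_pmf.prob p {\<omega>. X \<omega> = s}))"
    by (simp add: shannon_entropy_def)
  also have "(\<Sum>s\<in>range X. measure_pmf.prob p {\<omega>. X \<omega> = s} *
        log 2 (measure_pmf.prob p {\<omega>. X \<omega> = s})) =
      (\<Sum>s\<in>S. measure_pmf.prob p {\<omega>. X \<omega> = s} * log 2 (measure_pmf.prob p {\<omega>. X \<omega> = s}))"
  proof (rule sum.mono_neutral_left[OF S], intro ballI)
    fix s assume "s \<in> S - range X"
    then have "{\<omega>. X \<omega> = s} = {}" by auto
    then show "measure_pmf.prob p {\<omega>. X \<omega> = s} *
        log 2 (measure_pmf.prob p {\<omega>. X \<omega> = s}) = 0" by simp
  qed
  finally show ?thesis .
qed

lemma finite_edge_copies: "finite (edge_copies E)"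
  by (auto simp: edge_copies_def)

lemma card_edge_copies: "card (edge_copies E) = size E"
  by (simp add: edge_copies_def size_multiset_overloaded_eq)

lemma range_num_nonzero_in_degree:
  "finite V \<Longrightarrow> range (num_nonzero_in_degree V E) \<subseteq> {0..card V}"
  by (auto simp: num_nonzero_in_degree_def intro!: card_mono)

end

theory Submission
  imports Defs
begin

text \<open>
  Let \<open>Y\<close> be the number of vertices of in-degree zero, so that \<open>X = n - Y\<close>. The events that two given
  vertices have in-degree zero are negatively correlated, since an edge \<open>e\<close> contributes the factors
  \<open>1 - a - b \<le> (1 - a) (1 - b)\<close>, where \<open>a\<close> and \<open>b\<close> are the probabilities that \<open>e\<close> points to either of
  them. Hence \<open>Var X\<close> is at most the sum of the variances of \<open>n\<close> indicators, that is, at most \<open>n / 4\<close>.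
  On the other hand, comparing the distribution of an integer-valued variable with a normal
  distribution rounded to the nearest integer, Gibbs' inequality gives an entropy bound in terms of
  \<open>Var X + 1 / 12\<close>, where \<open>1 / 12\<close> is the variance of the rounding error. For the normal variance
  \<open>n / 2\<close> this is the claim, because \<open>n / 4 + 1 / 12 \<le> n / 2\<close>.
\<close>

section \<open>Entropy and variance of integer-valued random variables\<close>

text \<open>Gibbs' inequality. The weights \<open>q\<close> need only have total at most 1, because
  they will be lower bounds for the normal masses of unit intervals.\<close>

lemma shannon_entropy_le_cross_entropy:
  assumes S: "finite S" "range X \<subseteq> S"
    and q: "\<And>s. s \<in> S \<Longrightarrow> q s > 0" "sum q S \<le> 1"
  shows "shannon_entropy p X \<le> - measure_pmf.expectation p (\<lambda>\<omega>. log 2 (q (X \<omega>)))"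
proof -
  define P where "P s = measure_pmf.prob p {\<omega>. X \<omega> = s}" for s
  have P_map: "P s = pmf (map_pmf X p) s" for s
    by (simp add: P_def pmf_map vimage_def)
  have set_map: "set_pmf (map_pmf X p) \<subseteq> S"
    using S by auto
  have "measure_pmf.expectation p (\<lambda>\<omega>. log 2 (q (X \<omega>))) =
      measure_pmf.expectation (map_pmf X p) (\<lambda>s. log 2 (q s))"
    by simp
  also have "\<dots> = (\<Sum>s\<in>S. log 2 (q s) * P s)"
    using set_map unfolding P_map by (intro integral_measure_pmf_real[OF S(1)]) auto
  finally have expectation: "measure_pmf.expectation p (\<lambda>\<omega>. log 2 (q (X \<omega>))) =
      (\<Sum>s\<in>S. log 2 (q s) * P s)" .
  have P_sum: "sum P S = 1"
    unfolding P_map by (rule sum_pmf_eq_1[OF S(1) set_map])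
  \<comment> \<open>For \<open>P s > 0\<close> this is \<open>ln x \<le> x - 1\<close> at
    \<open>x = q s / P s\<close>, multiplied by \<open>P s\<close>. For \<open>P s = 0\<close> the
    left side vanishes and \<open>q s > 0\<close> suffices.\<close>
  have gibbs: "P s * ln (q s) - P s * ln (P s) \<le> q s - P s" if "s \<in> S" for s
  proof (cases "P s = 0")
    case False
    then have "P s > 0" by (simp add: P_def zero_less_measure_iff)
    then have "P s * ln (q s / P s) \<le> P s * (q s / P s - 1)"
      using q(1)[OF that] by (intro mult_left_mono ln_le_minus_one) auto
    then show ?thesis
      using q(1)[OF that] \<open>P s > 0\<close> by (simp add: ln_div algebra_simps)
  qed (use q(1)[OF that] in simp)
  have "(\<Sum>s\<in>S. P s * ln (q s) - P s * ln (P s)) \<le> (\<Sum>s\<in>S. q s - P s)"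
    by (rule sum_mono) (rule gibbs)
  also have "\<dots> \<le> 0"
    using q(2) P_sum by (simp add: sum_subtractf)
  finally have "((\<Sum>s\<in>S. P s * ln (q s)) - (\<Sum>s\<in>S. P s * ln (P s))) / ln 2 \<le> 0"
    by (simp add: sum_subtractf divide_le_0_iff)
  moreover have "shannon_entropy p X = - (\<Sum>s\<in>S. P s * log 2 (P s))"
    unfolding P_def by (rule shannon_entropy_eq_sum[OF S])
  ultimately show ?thesis
    unfolding expectation
    by (simp add: log_def sum_divide_distrib[symmetric] diff_divide_distrib mult.commute)
qed

text \<open>This is Jensen's inequality for the exponential function and a uniform point
  \<open>x\<close> of the unit interval around \<open>c\<close>: the mean of
  \<open>(x - \<mu>)\<^sup>2\<close> there is \<open>(c - \<mu>)\<^sup>2 + 1 / 12\<close>. The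
  interval is half-open so that those around different integers are disjoint.\<close>

lemma normal_density_interval_ge:
  fixes \<mu> \<sigma> c :: real
  assumes "\<sigma> > 0"
  shows "exp (- ((c - \<mu>)\<^sup>2 + 1 / 12) / (2 * \<sigma>\<^sup>2)) / sqrt (2 * pi * \<sigma>\<^sup>2)
    \<le> (\<integral>x. normal_density \<mu> \<sigma> x * indicator {c - 1 / 2<..c + 1 / 2} x \<partial>lborel)"
proof -
  define s where "s = 2 * \<sigma>\<^sup>2"
  define K where "K = exp (- ((c - \<mu>)\<^sup>2 + 1 / 12) / s) / sqrt (2 * pi * \<sigma>\<^sup>2)"
  define f where "f x = K * (1 - (2 * (c - \<mu>) * (x - c) + (x - c)\<^sup>2 - 1 / 12) / s)" for x
  define F where
    "F x = K * (x - ((c - \<mu>) * (x - c)\<^sup>2 + (x - c) ^ 3 / 3 - x / 12) / s)" for x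
  let ?I = "{c - 1 / 2..c + 1 / 2}"
  have s: "s > 0" using assms by (simp add: s_def)
  have K: "K \<ge> 0" by (simp add: K_def)
  \<comment> \<open>\<open>f\<close> is the linearization \<open>exp y \<ge> 1 + y\<close>, where \<open>1 / 12\<close> is the mean of \<open>(x - c)\<^sup>2\<close>.\<close>
  have f_le: "f x \<le> normal_density \<mu> \<sigma> x" for x
  proof -
    let ?y = "- ((2 * (c - \<mu>) * (x - c) + (x - c)\<^sup>2 - 1 / 12) / s)"
    have "f x = K * (1 + ?y)"
      by (simp add: f_def)
    also have "\<dots> \<le> K * exp ?y"
      using K by (intro mult_left_mono exp_ge_add_one_self)
    also have "\<dots> = exp (- ((c - \<mu>)\<^sup>2 + 1 / 12) / s + ?y) / sqrt (2 * pi * \<sigma>\<^sup>2)"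
      unfolding exp_add by (simp add: K_def)
    also have "- ((c - \<mu>)\<^sup>2 + 1 / 12) / s + ?y = - (x - \<mu>)\<^sup>2 / s"
      using s by (simp add: field_simps power2_eq_square)
    also have "exp (- (x - \<mu>)\<^sup>2 / s) / sqrt (2 * pi * \<sigma>\<^sup>2) = normal_density \<mu> \<sigma> x"
      by (simp add: normal_density_def s_def)
    finally show ?thesis .
  qed
  \<comment> \<open>\<open>F\<close> is an antiderivative of \<open>f\<close>. The correction terms
    in \<open>f\<close> have mean zero on \<open>?I\<close>, which leaves \<open>K\<close> times the
    length 1.\<close>
  have "K = F (c + 1 / 2) - F (c - 1 / 2)"
    using s by (simp add: F_def field_simps power2_eq_square power3_eq_cube)
  also have "\<dots> = (\<integral>x. f x * indicator ?I x \<partial>lborel)"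
  proof (rule integral_FTC_Icc_real[symmetric])
    show "DERIV F x :> f x" for x
      unfolding F_def f_def using s
      by (auto intro!: derivative_eq_intros simp: field_simps power2_eq_square)
    show "isCont f x" for x
      unfolding f_def using s by (auto intro!: continuous_intros)
  qed simp
  also have "\<dots> \<le> (\<integral>x. normal_density \<mu> \<sigma> x * indicator ?I x \<partial>lborel)"
  proof (rule integral_mono)
    show "integrable lborel (\<lambda>x. f x * indicator ?I x)"
    proof -
      have "continuous_on ?I f"
        unfolding f_def using s by (auto intro!: continuous_intros)
      then show ?thesis
        using borel_integrable_atLeastAtMost'[of "c - 1 / 2" "c + 1 / 2" f]
        by (simp add: set_integrable_def mult.commute)
    qed
    show "integrable lborel (\<lambda>x. normal_density \<mu> \<sigma> x * indicator ?I x)"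
      using assms by (intro integrable_real_mult_indicator) auto
  qed (use f_le in \<open>auto simp: indicator_def\<close>)
  also have "\<dots> = (\<integral>x. normal_density \<mu> \<sigma> x * indicator {c - 1 / 2<..c + 1 / 2} x \<partial>lborel)"
  proof (rule integral_cong_AE)
    show "AE x in lborel. normal_density \<mu> \<sigma> x * indicator ?I x =
        normal_density \<mu> \<sigma> x * indicator {c - 1 / 2<..c + 1 / 2} x"
      using AE_lborel_singleton[of "c - 1 / 2"] by eventually_elim (auto simp: indicator_def)
  qed auto
  finally show ?thesis
    by (simp add: K_def s_def)
qed

text \<open>Each summand is at most the normal mass of its own interval, and these disjoint
  intervals share a total mass of 1. So the summands are admissible weights for Gibbs'
  inequality.\<close>

lemma sum_exp_neg_square_le:
  fixes \<mu> \<sigma> :: real and S :: "nat set"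
  assumes "\<sigma> > 0" "finite S"
  shows "(\<Sum>k\<in>S. exp (- ((real k - \<mu>)\<^sup>2 + 1 / 12) / (2 * \<sigma>\<^sup>2)) / sqrt (2 * pi * \<sigma>\<^sup>2)) \<le> 1"
proof -
  let ?I = "\<lambda>k. {real k - 1 / 2<..real k + 1 / 2}"
  have int: "integrable lborel (\<lambda>x. normal_density \<mu> \<sigma> x * indicator (?I k) x)" for k
    using assms by (intro integrable_real_mult_indicator) auto
  have "(\<Sum>k\<in>S. exp (- ((real k - \<mu>)\<^sup>2 + 1 / 12) / (2 * \<sigma>\<^sup>2)) / sqrt (2 * pi * \<sigma>\<^sup>2))
      \<le> (\<Sum>k\<in>S. \<integral>x. normal_density \<mu> \<sigma> x * indicator (?I k) x \<partial>lborel)"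
    by (intro sum_mono normal_density_interval_ge assms)
  also have "\<dots> = (\<integral>x. (\<Sum>k\<in>S. normal_density \<mu> \<sigma> x * indicator (?I k) x) \<partial>lborel)"
    by (rule Bochner_Integration.integral_sum[symmetric]) (rule int)
  also have "\<dots> \<le> (\<integral>x. normal_density \<mu> \<sigma> x \<partial>lborel)"
  proof (rule integral_mono)
    show "integrable lborel (\<lambda>x. \<Sum>k\<in>S. normal_density \<mu> \<sigma> x * indicator (?I k) x)"
      by (intro Bochner_Integration.integrable_sum int)
    fix x :: real
    have "disjoint_family_on ?I S"
      by (auto simp: disjoint_family_on_def)
    then have "(\<Sum>k\<in>S. indicator (?I k) x :: real) = indicator (\<Union>k\<in>S. ?I k) x"
      using assms by (intro indicator_UN_disjoint[symmetric])
    also have "\<dots> \<le> 1"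
      by (rule indicator_le_1)
    finally show "(\<Sum>k\<in>S. normal_density \<mu> \<sigma> x * indicator (?I k) x) \<le> normal_density \<mu> \<sigma> x"
      using mult_left_mono[OF _ normal_density_nonneg, of _ 1 \<mu> \<sigma> x]
      by (simp add: sum_distrib_left[symmetric])
  qed (use assms in auto)
  finally show ?thesis
    using assms by simp
qed

text \<open>The logarithm of the weight \<open>q k\<close> is quadratic in \<open>k\<close>, so the
  cross entropy depends on \<open>X\<close> only through its second moment about
  \<open>\<mu>\<close>. Both \<open>\<mu>\<close> and \<open>\<sigma>\<close> remain free
  parameters.\<close>

lemma shannon_entropy_le_normal:
  fixes X :: "'a \<Rightarrow> nat" and \<mu> \<sigma> :: real
  assumes fin: "finite (range X)" and \<sigma>: "\<sigma> > 0"
  shows "shannon_entropy p X \<le> log 2 (sqrt (2 * pi * \<sigma>\<^sup>2)) +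
    (measure_pmf.expectation p (\<lambda>\<omega>. (real (X \<omega>) - \<mu>)\<^sup>2) + 1 / 12) / (2 * \<sigma>\<^sup>2) * log 2 (exp 1)"
proof -
  define q where
    "q k = exp (- ((real k - \<mu>)\<^sup>2 + 1 / 12) / (2 * \<sigma>\<^sup>2)) / sqrt (2 * pi * \<sigma>\<^sup>2)" for k
  define L :: real where "L = log 2 (exp 1)"
  have log_q: "log 2 (q k) =
      - (((real k - \<mu>)\<^sup>2 + 1 / 12) / (2 * \<sigma>\<^sup>2) * L + log 2 (sqrt (2 * pi * \<sigma>\<^sup>2)))" for k
    using \<sigma> unfolding q_def by (subst log_divide) (auto simp: L_def field_simps)
  \<comment> \<open>Splitting the expectation linearly requires integrability, which holds because
    \<open>X\<close> takes finitely many values.\<close>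
  have "integrable (measure_pmf p) (\<lambda>\<omega>. (real (X \<omega>) - \<mu>)\<^sup>2)"
  proof (rule measure_pmf.integrable_const_bound)
    show "AE \<omega> in measure_pmf p.
        norm ((real (X \<omega>) - \<mu>)\<^sup>2) \<le> Max ((\<lambda>k. (real k - \<mu>)\<^sup>2) ` range X)"
      using fin by (auto intro!: AE_I2 Max_ge)
  qed simp
  then have "measure_pmf.expectation p (\<lambda>\<omega>. log 2 (q (X \<omega>))) =
      - ((measure_pmf.expectation p (\<lambda>\<omega>. (real (X \<omega>) - \<mu>)\<^sup>2) + 1 / 12) / (2 * \<sigma>\<^sup>2) * L +
        log 2 (sqrt (2 * pi * \<sigma>\<^sup>2)))"
    unfolding log_q by simp
  moreover have "shannon_entropy p X \<le> - measure_pmf.expectation p (\<lambda>\<omega>. log 2 (q (X \<omega>)))"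
  proof (rule shannon_entropy_le_cross_entropy[OF fin order_refl])
    show "q s > 0" for s using \<sigma> by (simp add: q_def)
    show "sum q (range X) \<le> 1"
      unfolding q_def by (rule sum_exp_neg_square_le[OF \<sigma> fin])
  qed
  ultimately show ?thesis
    by (simp add: L_def)
qed

section \<open>Variance of the number of vertices with non-zero in-degree\<close>

lemma expectation_of_bool:
  "measure_pmf.expectation p (\<lambda>\<omega>. of_bool (P \<omega>)) = measure_pmf.prob p {\<omega>. P \<omega>}"
proof -
  have "(\<lambda>\<omega>. of_bool (P \<omega>)) = (indicator {\<omega>. P \<omega>} :: _ \<Rightarrow> real)"
    by (auto simp: indicator_def)
  then show ?thesis by simp
qed

lemma integrable_of_bool_pmf:
  "integrable (measure_pmf p) (\<lambda>\<omega>. of_bool (P \<omega>) :: real)"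
  by (rule measure_pmf.integrable_const_bound[where B = 1]) auto

text \<open>The subtracted sum is the mean of the count, so the left side is a variance and expands
  into covariances. Those off the diagonal are nonpositive by \<open>neg\<close>; those on it have
  the form \<open>t - t * t \<le> 1 / 4\<close>.\<close>

lemma second_moment_sum_indicators_le:
  fixes P :: "'i \<Rightarrow> 'a \<Rightarrow> bool"
  assumes "finite V"
    and neg: "\<And>u v. u \<in> V \<Longrightarrow> v \<in> V \<Longrightarrow> u \<noteq> v \<Longrightarrow>
      measure_pmf.prob p {\<omega>. P u \<omega> \<and> P v \<omega>} \<le>
      measure_pmf.prob p {\<omega>. P u \<omega>} * measure_pmf.prob p {\<omega>. P v \<omega>}"
  shows "measure_pmf.expectation p
      (\<lambda>\<omega>. (real (card {v \<in> V. P v \<omega>}) - (\<Sum>v\<in>V. measure_pmf.prob p {\<omega>. P v \<omega>}))\<^sup>2)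
    \<le> real (card V) / 4"
proof -
  define \<pi> where "\<pi> v = measure_pmf.prob p {\<omega>. P v \<omega>}" for v
  have cov: "((of_bool (P u \<omega>) - \<pi> u) * (of_bool (P v \<omega>) - \<pi> v) :: real) =
      of_bool (P u \<omega> \<and> P v \<omega>) - \<pi> v * of_bool (P u \<omega>) - \<pi> u * of_bool (P v \<omega>) + \<pi> u * \<pi> v"
    for u v \<omega> by (simp add: algebra_simps)
  have int: "integrable (measure_pmf p)
      (\<lambda>\<omega>. (of_bool (P u \<omega>) - \<pi> u) * (of_bool (P v \<omega>) - \<pi> v) :: real)" for u v
    unfolding cov by (intro Bochner_Integration.integrable_add Bochner_Integration.integrable_diff
        integrable_mult_right integrable_of_bool_pmf) auto
  have exp_cov: "measure_pmf.expectation p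
      (\<lambda>\<omega>. (of_bool (P u \<omega>) - \<pi> u) * (of_bool (P v \<omega>) - \<pi> v)) =
      measure_pmf.prob p {\<omega>. P u \<omega> \<and> P v \<omega>} - \<pi> u * \<pi> v" for u v
    unfolding cov
    by (simp add: integrable_of_bool_pmf expectation_of_bool \<pi>_def del: of_bool_conj)
  have card: "real (card {v \<in> V. P v \<omega>}) = (\<Sum>v\<in>V. of_bool (P v \<omega>))" for \<omega>
    using \<open>finite V\<close> by (simp add: of_bool_def sum.If_cases Int_def)
  have sq: "(real (card {v \<in> V. P v \<omega>}) - sum \<pi> V)\<^sup>2 =
      (\<Sum>u\<in>V. \<Sum>v\<in>V. (of_bool (P u \<omega>) - \<pi> u) * (of_bool (P v \<omega>) - \<pi> v))" for \<omega>
    unfolding card by (simp add: sum_subtractf[symmetric] power2_eq_square sum_product)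
  have "measure_pmf.expectation p (\<lambda>\<omega>. (real (card {v \<in> V. P v \<omega>}) - sum \<pi> V)\<^sup>2) =
      (\<Sum>u\<in>V. \<Sum>v\<in>V. measure_pmf.prob p {\<omega>. P u \<omega> \<and> P v \<omega>} - \<pi> u * \<pi> v)"
    unfolding sq by (simp add: Bochner_Integration.integral_sum Bochner_Integration.integrable_sum
        int exp_cov del: of_bool_conj)
  also have "\<dots> \<le> (\<Sum>u\<in>V. \<Sum>v\<in>V. if u = v then 1 / 4 else 0)"
  proof (intro sum_mono)
    fix u v assume "u \<in> V" "v \<in> V"
    moreover have "\<pi> u - \<pi> u * \<pi> u \<le> 1 / 4"
      using zero_le_square[of "\<pi> u - 1 / 2"] by (simp add: algebra_simps)
    ultimately show "measure_pmf.prob p {\<omega>. P u \<omega> \<and> P v \<omega>} - \<pi> u * \<pi> v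
        \<le> (if u = v then 1 / 4 else 0)"
      using neg[of u v] by (auto simp: \<pi>_def)
  qed
  also have "\<dots> = real (card V) / 4"
    using \<open>finite V\<close> by (simp add: sum.delta)
  finally show ?thesis
    by (simp add: \<pi>_def)
qed

lemma prob_avoid_two_vertices_le:
  assumes "u \<noteq> v"
  shows "measure_pmf.prob (random_orientation E) {\<omega>. (\<forall>c\<in>edge_copies E. \<omega> c \<noteq> u) \<and>
      (\<forall>c\<in>edge_copies E. \<omega> c \<noteq> v)}
    \<le> measure_pmf.prob (random_orientation E) {\<omega>. \<forall>c\<in>edge_copies E. \<omega> c \<noteq> u} *
      measure_pmf.prob (random_orientation E) {\<omega>. \<forall>c\<in>edge_copies E. \<omega> c \<noteq> v}"
proof -
  define D :: "'a set \<times> nat \<Rightarrow> 'a pmf" where "D = (\<lambda>(e, i). pmf_of_set e)"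
  \<comment> \<open>By independence of the copies the probability is a product. A general set
    \<open>A\<close> covers all three events: avoiding \<open>u\<close>, avoiding \<open>v\<close>,
    and avoiding both.\<close>
  have prob_avoid: "measure_pmf.prob (random_orientation E) {\<omega>. \<forall>c\<in>edge_copies E. \<omega> c \<notin> A} =
      (\<Prod>c\<in>edge_copies E. 1 - measure_pmf.prob (D c) A)" for A
  proof -
    have "{\<omega>. \<forall>c\<in>edge_copies E. \<omega> c \<notin> A} = Pi (edge_copies E) (\<lambda>_. - A)"
      by auto
    then show ?thesis
      by (simp add: random_orientation_def D_def measure_Pi_pmf_Pi[OF finite_edge_copies]
          measure_pmf.prob_compl[of A, simplified] Compl_eq_Diff_UNIV)
  qed
  \<comment> \<open>The right side exceeds the left by the product of the two point
    probabilities.\<close>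
  have factor: "1 - measure_pmf.prob (D c) {u, v} \<le>
      (1 - measure_pmf.prob (D c) {u}) * (1 - measure_pmf.prob (D c) {v})" for c
  proof -
    have "measure_pmf.prob (D c) {u, v} =
        measure_pmf.prob (D c) {u} + measure_pmf.prob (D c) {v}"
      using assms measure_pmf.finite_measure_Union[of "{u}" "D c" "{v}"]
      by (simp add: insert_commute)
    then show ?thesis
      by (simp add: algebra_simps)
  qed
  have "(\<Prod>c\<in>edge_copies E. 1 - measure_pmf.prob (D c) {u, v}) \<le>
      (\<Prod>c\<in>edge_copies E. (1 - measure_pmf.prob (D c) {u}) * (1 - measure_pmf.prob (D c) {v}))"
    by (intro prod_mono conjI factor) simp
  then show ?thesis
    using prob_avoid[of "{u, v}"] prob_avoid[of "{u}"] prob_avoid[of "{v}"]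
    by (simp add: prod.distrib ball_conj_distrib)
qed

text \<open>Passing to the complementary count of vertices that no copy points to only reflects the
  variable, so squared deviations are unchanged. The witness for \<open>\<mu>\<close> is the mean,
  but the entropy bound accepts any centre.\<close>

lemma second_moment_num_nonzero_in_degree_le:
  assumes "finite V"
  obtains \<mu> where "measure_pmf.expectation (random_orientation E)
      (\<lambda>\<omega>. (real (num_nonzero_in_degree V E \<omega>) - \<mu>)\<^sup>2) \<le> real (card V) / 4"
proof
  let ?P = "\<lambda>v \<omega>. \<forall>c\<in>edge_copies E. \<omega> c \<noteq> v"
  let ?y = "\<Sum>v\<in>V. measure_pmf.prob (random_orientation E) {\<omega>. ?P v \<omega>}"
  have "real (num_nonzero_in_degree V E \<omega>) = real (card V) - real (card {v \<in> V. ?P v \<omega>})" for \<omega>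
  proof -
    have "{v \<in> V. in_degree E \<omega> v > 0} = V - {v \<in> V. ?P v \<omega>}"
      by (auto simp: in_degree_def card_gt_0_iff finite_edge_copies)
    then show ?thesis
      using assms
      by (simp add: num_nonzero_in_degree_def card_Diff_subset of_nat_diff card_mono)
  qed
  then have "(real (num_nonzero_in_degree V E \<omega>) - (real (card V) - ?y))\<^sup>2 =
      (real (card {v \<in> V. ?P v \<omega>}) - ?y)\<^sup>2" for \<omega>
    by (simp add: power2_commute)
  then show "measure_pmf.expectation (random_orientation E)
      (\<lambda>\<omega>. (real (num_nonzero_in_degree V E \<omega>) - (real (card V) - ?y))\<^sup>2) \<le> real (card V) / 4"
    using second_moment_sum_indicators_le[OF assms, of "random_orientation E" ?P]
      prob_avoid_two_vertices_le[of _ _ E] by simp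
qed

theorem theorem1p4:
  fixes m n r :: nat and V :: "'v set" and E :: "'v set multiset"
  assumes "m \<ge> n" and "n > r" and "r \<ge> 2"
    and "uniform_multi_hypergraph r V E"
    and "card V = n" and "size E = m"
  shows "shannon_entropy (random_orientation E) (num_nonzero_in_degree V E)
    \<le> 1 / 2 * log 2 (real n) + 1 / 2 * log 2 (pi * exp 1)"
proof -
  have "finite V"
    using assms by (simp add: uniform_multi_hypergraph_def)
  have n: "real n \<ge> 1" "real n > 0"
    using assms by auto
  \<comment> \<open>This choice turns \<open>2 * pi * \<sigma>\<^sup>2\<close> into
    \<open>pi * real n\<close>, whose square root contributes every term of the claim except
    \<open>1 / 2 * log 2 (exp 1)\<close>.\<close>
  define \<sigma> where "\<sigma> = sqrt (real n / 2)"
  have \<sigma>: "\<sigma> > 0" "2 * \<sigma>\<^sup>2 = real n"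
    using n by (auto simp: \<sigma>_def)
  obtain \<mu> where \<mu>: "measure_pmf.expectation (random_orientation E)
      (\<lambda>\<omega>. (real (num_nonzero_in_degree V E \<omega>) - \<mu>)\<^sup>2) \<le> real (card V) / 4" (is "?v \<le> _")
    using second_moment_num_nonzero_in_degree_le[OF \<open>finite V\<close>] by blast
  have fin: "finite (range (num_nonzero_in_degree V E))"
    using range_num_nonzero_in_degree[OF \<open>finite V\<close>] by (rule finite_subset) simp
  have pi_n: "2 * pi * \<sigma>\<^sup>2 = pi * real n"
    using \<sigma>(2) by simp
  have "shannon_entropy (random_orientation E) (num_nonzero_in_degree V E) \<le>
      log 2 (sqrt (pi * real n)) + (?v + 1 / 12) / real n * log 2 (exp 1)"
    using shannon_entropy_le_normal[OF fin \<sigma>(1), of "random_orientation E" \<mu>]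
    unfolding pi_n \<sigma>(2) .
  \<comment> \<open>With \<open>?v \<le> real n / 4\<close> this reduces to
    \<open>1 / 12 \<le> real n / 4\<close>, which follows from
    \<open>real n \<ge> 1\<close>.\<close>
  also have "(?v + 1 / 12) / real n * log 2 (exp 1) \<le> 1 / 2 * log 2 (exp 1)"
    using \<mu> n \<open>card V = n\<close> by (intro mult_right_mono) (auto simp: field_simps)
  also have "log 2 (sqrt (pi * real n)) = 1 / 2 * log 2 (real n) + 1 / 2 * log 2 pi"
    using n by (simp add: log_def ln_sqrt ln_mult field_simps)
  finally show ?thesis
    by (simp add: log_mult algebra_simps)
qed

end
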